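(* Let $(X,d)$ be a metric space. Then for any $p,x\in X$ with $x\neq p$ the angle cone $\boldsymbol{\angle}_{pxp}$ reduces to a single angle: $\boldsymbol{\angle}_{pxp}=\{\theta\}$ for some $\theta\in[0,\pi]$. If moreover $(X,d)$ is a length space, then $\boldsymbol{\angle}_{pxp}=\{0\}$.
   Context: A metric space $(X,d)$ is a length space if for every $x_0,x_1\in X$ the infimum of the lengths of continuous curves joining $x_0$ to $x_1$ equals $d(x_0,x_1)$. Slope: for $f:X\to\mathbb R$, $|Df|(x):=\limsup_{y\to x}\frac{|f(y)-f(x)|}{d(y,x)}$ if $x$ is not isolated, and $|Df|(x):=0$ if $x$ is isolated. For $f,g:X\to\mathbb R$ with finite slopes, the functions $D^{\pm}f(\nabla g):X\to\mathbb R$ are defined pointwise by $$D^{+}f(\nabla g):=\liminf_{\varepsilon\downarrow0}\frac{|D(g+\varepsilon f)|^2-|Dg|^2}{2\varepsilon},\qquad D^{-}f(\nabla g):=\limsup_{\varepsilon\uparrow0}\frac{|D(g+\varepsilon f)|^2-|Dg|^2}{2\varepsilon}$$ on $\{|Dg|\neq0\}$, and are $0$ by definition on $\{|Dg|=0\}$. Angle cone: for $p,x,q\in X$ let $r_p:=d(p,\cdot)$, $r_q:=d(q,\cdot)$, $c^{\pm}_{pxq}:=D^{\pm}r_p(\nabla r_q)(x)$ (these lie in $[-1,1]$ and $c^-_{pxq}\le c^+_{pxq}$), $\angle^-_{pxq}:=\arccos c^+_{pxq}$, $\angle^+_{pxq}:=\arccos c^-_{pxq}$. The angle cone of $(p,x,q)$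 is the interval $\boldsymbol{\angle}_{pxq}:=[\angle^-_{pxq},\angle^+_{pxq}]\subset[0,\pi]$; here it is used with $q=p$. *)

theory Defs
  imports "HOL-Analysis.Analysis"
begin

text \<open>The supremum of the polygonal lengths over all finite increasing
  sequences of parameters in \<open>[0,1]\<close>; it may be infinite.\<close>

definition curve_length :: "(real \<Rightarrow> 'a::metric_space) \<Rightarrow> ereal" where
  "curve_length \<gamma> =
     (SUP ts \<in> {ts. sorted ts \<and> set ts \<subseteq> {0..1}}.
        ereal (\<Sum>i<length ts - 1. dist (\<gamma> (ts ! i)) (\<gamma> (ts ! Suc i))))"

text \<open>The infimum over an empty set of curves is \<open>\<infinity>\<close>, so a length space is path connected.\<close>

definition length_space :: "'a::metric_space itself \<Rightarrow> bool" where
  "length_space _ \<longleftrightarrow>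
     (\<forall>x0 x1 :: 'a.
        (INF \<gamma> \<in> {\<gamma>. path \<gamma> \<and> pathstart \<gamma> = x0 \<and> pathfinish \<gamma> = x1}. curve_length \<gamma>)
          = ereal (dist x0 x1))"

text \<open>The filter \<open>at x\<close> excludes \<open>x\<close> itself. Isolated points need their own case because
  the limsup along the trivial filter would be \<open>-\<infinity>\<close>.\<close>

definition slope :: "('a::metric_space \<Rightarrow> real) \<Rightarrow> 'a \<Rightarrow> ereal" where
  "slope f x =
     (if x isolated_in UNIV then 0
      else Limsup (at x) (\<lambda>y. ereal (\<bar>f y - f x\<bar> / dist y x)))"

text \<open>\<open>D_plus f g x\<close> and \<open>D_minus f g x\<close> stand for \<open>D\<^sup>+f(\<nabla>g)(x)\<close> and \<open>D\<^sup>-f(\<nabla>g)(x)\<close>; they are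
  meant for functions \<open>f\<close> and \<open>g\<close> with finite slopes.\<close>

definition D_plus :: "('a::metric_space \<Rightarrow> real) \<Rightarrow> ('a \<Rightarrow> real) \<Rightarrow> 'a \<Rightarrow> ereal" where
  "D_plus f g x =
     (if slope g x = 0 then 0
      else Liminf (at_right 0) (\<lambda>\<epsilon>::real.
             ((slope (\<lambda>y. g y + \<epsilon> * f y) x)\<^sup>2 - (slope g x)\<^sup>2) / ereal (2 * \<epsilon>)))"

definition D_minus :: "('a::metric_space \<Rightarrow> real) \<Rightarrow> ('a \<Rightarrow> real) \<Rightarrow> 'a \<Rightarrow> ereal" where
  "D_minus f g x =
     (if slope g x = 0 then 0
      else Limsup (at_left 0) (\<lambda>\<epsilon>::real.
             ((slope (\<lambda>y. g y + \<epsilon> * f y) x)\<^sup>2 - (slope g x)\<^sup>2) / ereal (2 * \<epsilon>)))"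

text \<open>Distance functions are 1-Lipschitz, so the values below lie in \<open>[-1,1]\<close> and the passage
  from \<open>ereal\<close> to \<open>real\<close> loses nothing.\<close>

definition cos_plus :: "'a::metric_space \<Rightarrow> 'a \<Rightarrow> 'a \<Rightarrow> real" where
  "cos_plus p x q = real_of_ereal (D_plus (dist p) (dist q) x)"

definition cos_minus :: "'a::metric_space \<Rightarrow> 'a \<Rightarrow> 'a \<Rightarrow> real" where
  "cos_minus p x q = real_of_ereal (D_minus (dist p) (dist q) x)"

text \<open>The larger cosine \<open>cos_plus\<close> gives the smaller angle, which is the left endpoint.\<close>

definition angle_minus :: "'a::metric_space \<Rightarrow> 'a \<Rightarrow> 'a \<Rightarrow> real" where
  "angle_minus p x q = arccos (cos_plus p x q)"

definition angle_plus :: "'a::metric_space \<Rightarrow> 'a \<Rightarrow> 'a \<Rightarrow> real" where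
  "angle_plus p x q = arccos (cos_minus p x q)"

definition angle_cone :: "'a::metric_space \<Rightarrow> 'a \<Rightarrow> 'a \<Rightarrow> real set" where
  "angle_cone p x q = {angle_minus p x q..angle_plus p x q}"

end

(*
  Since r_p + e r_p = (1 + e) r_p and the slope is absolutely homogeneous, both difference quotients
  tend to s^2, where s = |D r_p|(x), so the only angle is arccos (s^2). In a length space s = 1:
  a point y at a small distance r from x on an almost shortest curve from p to x satisfies
  d(p,x) - d(p,y) >= r - o(r).
*)
theory Submission
  imports Defs
begin

lemma isolated_in_UNIV_iff: "x isolated_in UNIV \<longleftrightarrow> at (x::'a::metric_space) = bot"
  unfolding isolated_in_islimpt_iff trivial_limit_within by blast

text \<open>The factor comes out of each difference quotient and then out of the limsup. The
  isolated case is separate: along the trivial filter the limsup is -\<infinity>, and both slopes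
  are 0 by convention.\<close>

lemma slope_cmult: "slope (\<lambda>y. c * f y) x = ereal \<bar>c\<bar> * slope f x"
proof (cases "x isolated_in UNIV")
  case False
  then have "at x \<noteq> bot"
    by (simp add: isolated_in_UNIV_iff)
  moreover have "ereal (\<bar>c * f y - c * f x\<bar> / dist y x) = ereal \<bar>c\<bar> * ereal (\<bar>f y - f x\<bar> / dist y x)" for y
    by (simp flip: right_diff_distrib add: abs_mult)
  ultimately show ?thesis
    using False Limsup_ereal_mult_left[of "at x" "\<bar>c\<bar>" "\<lambda>y. ereal (\<bar>f y - f x\<bar> / dist y x)"]
    by (simp only: slope_def if_False abs_ge_zero not_False_eq_True simp_thms)
qed (simp add: slope_def)

lemma slope_nonneg: "0 \<le> slope f x"
  by (auto simp: slope_def isolated_in_UNIV_iff intro!: le_Limsup)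

lemma slope_dist_le_1: "slope (dist p) x \<le> 1"
proof -
  have "\<bar>dist p y - dist p x\<bar> / dist y x \<le> 1" for y
    using abs_dist_diff_le[of y p x] by (cases "y = x") (simp_all add: dist_commute)
  then show ?thesis
    by (auto simp: slope_def one_ereal_def intro!: Limsup_bounded)
qed

text \<open>This is ((1 + \<epsilon>)^2 - 1) / (2 * \<epsilon>) = 1 + \<epsilon> / 2, for either
  sign of \<epsilon>. Taking \<open>s\<close> real keeps the difference of squares finite.\<close>

lemma scaled_square_quotient:
  assumes "\<epsilon> \<noteq> (0::real)"
  shows "((ereal \<bar>1 + \<epsilon>\<bar> * ereal s)\<^sup>2 - (ereal s)\<^sup>2) / ereal (2 * \<epsilon>) = ereal (s\<^sup>2 * (1 + \<epsilon> / 2))"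
  using assms by (simp add: power_mult_distrib) (simp add: field_simps power2_eq_square)

text \<open>The quotient has a genuine two-sided limit at 0, which the liminf from the right and the
  limsup from the left both inherit.\<close>

lemma
  assumes "slope g x = ereal s"
  shows D_plus_self: "D_plus g g x = ereal (s\<^sup>2)"
    and D_minus_self: "D_minus g g x = ereal (s\<^sup>2)"
proof -
  let ?q = "\<lambda>\<epsilon>. ((slope (\<lambda>y. g y + \<epsilon> * g y) x)\<^sup>2 - (slope g x)\<^sup>2) / ereal (2 * \<epsilon>)"
  have "?q \<epsilon> = ereal (s\<^sup>2 * (1 + \<epsilon> / 2))" if "\<epsilon> \<noteq> 0" for \<epsilon>
  proof -
    have "(\<lambda>y. g y + \<epsilon> * g y) = (\<lambda>y. (1 + \<epsilon>) * g y)"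
      by (simp add: algebra_simps)
    then show ?thesis
      using scaled_square_quotient[OF that] by (simp only: slope_cmult assms)
  qed
  then have "\<forall>\<^sub>F \<epsilon> in at 0. ereal (s\<^sup>2 * (1 + \<epsilon> / 2)) = ?q \<epsilon>"
    by (simp add: eventually_at_filter)
  moreover have "((\<lambda>\<epsilon>. ereal (s\<^sup>2 * (1 + \<epsilon> / 2))) \<longlongrightarrow> ereal (s\<^sup>2)) (at 0)"
    by (auto intro!: tendsto_eq_intros)
  ultimately have "(?q \<longlongrightarrow> ereal (s\<^sup>2)) (at 0)"
    by (rule Lim_transform_eventually[rotated])
  then have "(?q \<longlongrightarrow> ereal (s\<^sup>2)) (at_right 0)" "(?q \<longlongrightarrow> ereal (s\<^sup>2)) (at_left 0)"
    by (simp_all add: filterlim_at_split)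
  then have "Liminf (at_right 0) ?q = ereal (s\<^sup>2)" "Limsup (at_left 0) ?q = ereal (s\<^sup>2)"
    by (simp_all add: lim_imp_Liminf lim_imp_Limsup)
  \<comment> \<open>If the slope vanishes, then \<open>s = 0\<close> and the default value 0 agrees
    with the square of \<open>s\<close>.\<close>
  then show "D_plus g g x = ereal (s\<^sup>2)" "D_minus g g x = ereal (s\<^sup>2)"
    using assms by (auto simp: D_plus_def D_minus_def)
qed

lemma angle_cone_same:
  assumes "slope (dist p) x = ereal s"
  shows "angle_cone p x p = {arccos (s\<^sup>2)}"
  using D_plus_self[OF assms] D_minus_self[OF assms]
  by (simp add: angle_cone_def angle_minus_def angle_plus_def cos_plus_def cos_minus_def)

text \<open>The polygon with parameters 0, \<open>t\<close>, 1 competes in the supremum.\<close>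

lemma dist_add_dist_le_curve_length:
  assumes "t \<in> {0..1}"
  shows "ereal (dist (\<gamma> 0) (\<gamma> t) + dist (\<gamma> t) (\<gamma> 1)) \<le> curve_length \<gamma>"
  unfolding curve_length_def
  using assms by (intro SUP_upper2[of "[0, t, 1]"]) (auto simp: numeral_2_eq_2)

lemma length_space_almost_between:
  fixes p x :: "'a::metric_space"
  assumes "length_space TYPE('a)" "0 < r" "r < dist p x" "0 < \<eta>"
  obtains y where "dist y x = r" "dist p y + r \<le> dist p x + \<eta>"
proof -
  have "(INF \<gamma> \<in> {\<gamma>. path \<gamma> \<and> pathstart \<gamma> = p \<and> pathfinish \<gamma> = x}. curve_length \<gamma>)
      < ereal (dist p x + \<eta>)"
    using assms by (simp add: length_space_def)
  then obtain \<gamma> where \<gamma>: "path \<gamma>" "\<gamma> 0 = p" "\<gamma> 1 = x" "curve_length \<gamma> < ereal (dist p x + \<eta>)"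
    by (auto simp: INF_less_iff pathstart_def pathfinish_def)
  \<comment> \<open>The distance to \<open>x\<close> along the curve falls from
    \<open>dist p x > r\<close> to 0, so it takes the value \<open>r\<close>.\<close>
  have "\<exists>t\<ge>0. t \<le> 1 \<and> dist (\<gamma> t) x = r"
    using \<gamma> assms by (intro IVT2') (auto simp: path_def intro!: continuous_intros)
  then obtain t where t: "t \<in> {0..1}" "dist (\<gamma> t) x = r"
    by auto
  have "ereal (dist p (\<gamma> t) + r) < ereal (dist p x + \<eta>)"
    using dist_add_dist_le_curve_length[OF t(1), of \<gamma>] \<gamma>(4)
    unfolding \<gamma>(2,3) t(2) by (rule le_less_trans)
  with t show ?thesis
    by (intro that[of "\<gamma> t"]) auto
qed

lemma slope_dist_length_space:
  fixes p x :: "'a::metric_space"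
  assumes "length_space TYPE('a)" "x \<noteq> p"
  shows "slope (dist p) x = 1"
proof (rule antisym[OF slope_dist_le_1])
  let ?q = "\<lambda>y. \<bar>dist p y - dist p x\<bar> / dist y x"
  have near: "\<exists>y. y \<noteq> x \<and> dist y x < d \<and> c < ?q y" if cd: "c < 1" "0 < d" for c d
  proof -
    \<comment> \<open>Halving makes \<open>r\<close> strictly smaller than both \<open>d\<close> and
      \<open>dist p x\<close>, the latter being positive since \<open>x \<noteq> p\<close>.\<close>
    define r where "r = min d (dist p x) / 2"
    have r: "0 < r" "r < dist p x" "r < d"
      using assms cd by (auto simp: r_def min_def)
    \<comment> \<open>With this excess the distance to \<open>p\<close> drops by at least r - r * (1
      - c) / 2 = r * (1 + c) / 2, which exceeds \<open>c * r\<close> because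
      \<open>c < 1\<close>.\<close>
    obtain y where y: "dist y x = r" "dist p y + r \<le> dist p x + r * ((1 - c) / 2)"
      by (rule length_space_almost_between[OF assms(1) r(1,2), of "r * ((1 - c) / 2)"])
        (use r cd in simp_all)
    have "0 < r * (1 - c)"
      using r cd by simp
    then have "c * r < dist p x - dist p y"
      using y by (simp add: field_simps)
    then have "c * r < \<bar>dist p y - dist p x\<bar>"
      by linarith
    with y r show ?thesis
      by (intro exI[of _ y]) (auto simp: field_simps)
  qed
  have freq: "\<exists>\<^sub>F y in at x. c < ?q y" if "c < 1" for c
    using near[OF that] by (auto simp: frequently_at)
  \<comment> \<open>Nothing holds frequently along the trivial filter.\<close>
  have "\<not> x isolated_in UNIV"
    using freq[of 0] by (auto simp: isolated_in_UNIV_iff frequently_def)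
  moreover have "1 \<le> Limsup (at x) (\<lambda>y. ereal (?q y))"
  proof (rule ccontr)
    assume "\<not> 1 \<le> Limsup (at x) (\<lambda>y. ereal (?q y))"
    then have "Limsup (at x) (\<lambda>y. ereal (?q y)) < 1"
      by (simp only: not_le)
    \<comment> \<open>A real \<open>c\<close> strictly between the limsup and 1 would bound the
      quotient from above near \<open>x\<close>, against \<open>freq\<close>.\<close>
    from ereal_dense2[OF this]
    obtain c where c: "Limsup (at x) (\<lambda>y. ereal (?q y)) < ereal c" "ereal c < 1"
      by auto
    have "\<forall>\<^sub>F y in at x. \<not> c < ?q y"
      using Limsup_lessD[OF c(1)] by eventually_elim auto
    then show False
      using freq[of c] c(2) by (simp add: frequently_def)
  qed
  ultimately show "1 \<le> slope (dist p) x"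
    by (simp add: slope_def)
qed

theorem proposition2p9:
  fixes p x :: "'a::metric_space"
  assumes "x \<noteq> p"
  shows "(\<exists>\<theta>\<in>{0..pi}. angle_cone p x p = {\<theta>}) \<and>
         (length_space TYPE('a) \<longrightarrow> angle_cone p x p = {0})"
proof -
  obtain s where s: "slope (dist p) x = ereal s" "0 \<le> s" "s \<le> 1"
    using slope_nonneg[of "dist p" x] slope_dist_le_1[of p x]
    by (cases "slope (dist p) x") auto
  \<comment> \<open>These bounds put the square of \<open>s\<close> in the domain of
    \<open>arccos\<close>; in a length space its value is 1, and the angle is 0.\<close>
  have "s\<^sup>2 \<le> 1"
    using s by (simp add: power_le_one)
  moreover have "-1 \<le> s\<^sup>2"
    using zero_le_power2[of s] by linarith
  ultimately have "arccos (s\<^sup>2) \<in> {0..pi}"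
    using arccos_bounded[of "s\<^sup>2"] by simp
  moreover have "s = 1" if "length_space TYPE('a)"
    using slope_dist_length_space[OF that assms] s by simp
  ultimately show ?thesis
    using angle_cone_same[OF s(1)] by auto
qed

end
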